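(* Let $m\ge2$ be an integer and let $\beta>1$ satisfy $\beta^2=m\beta+1$. Then $L_\oplus(-\beta)=1=L_\otimes(-\beta)$.
   Context: For $\beta>1$, let $I_\beta=\big[\frac{-\beta}{\beta+1},\frac1{\beta+1}\big)$ and $T_{-\beta}:I_\beta\to I_\beta$, $T_{-\beta}(x)=-\beta x-\lfloor -\beta x+\frac{\beta}{\beta+1}\rfloor$. For $y\in I_\beta$ put $y_i=\lfloor -\beta T_{-\beta}^{i-1}(y)+\frac{\beta}{\beta+1}\rfloor$ ($i\ge1$) and $d_{-\beta}(y)=y_1y_2y_3\cdots$. The $(-\beta)$-expansion of a real $x$: take the minimal non-negative integer $j$ with $y=x(-\beta)^{-j}\in\big(\frac{-\beta}{\beta+1},\frac1{\beta+1}\big)$, compute $d_{-\beta}(y)=y_1y_2\cdots$; the expansion is $x=\sum_{i\ge1}y_i(-\beta)^{j-i}$ with digit $y_i$ the coefficient of $(-\beta)^{j-i}$. $\mathrm{Fin}(-\beta)$ is the set of reals whose $(-\beta)$-expansion has finitely many non-zero digits, and $\mathbb{Z}_{-\beta}$ is the set of reals whose $(-\beta)$-expansion has no non-zero digit at negative powers of $(-\beta)$. Define $L_\oplus(-\beta)=\min\{l\in\mathbb{N}\mid \forall x,y\in\mathbb{Z}_{-\beta}:\ x+y\in\mathrm{Fin}(-\beta)\Rightarrow x+y\in(-\beta)^{-l}\mathbb{Z}_{-\beta}\}$ and $L_\otimes(-\beta)=\min\{l\in\mathbb{N}\mid \forall x,y\in\mathbb{Z}_{-\beta}:\ xy\in\mathrm{Fin}(-\beta)\Rightarrow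 xy\in(-\beta)^{-l}\mathbb{Z}_{-\beta}\}$. *)

theory Defs
  imports Complex_Main "HOL-Library.Extended_Nat"
begin

(* For \<beta> > 1 this maps the interval I = {- \<beta> / (\<beta> + 1) ..< 1 / (\<beta> + 1)} to itself; it is only
   ever iterated on points of I. *)
definition T_neg :: "real \<Rightarrow> real \<Rightarrow> real" where
  "T_neg \<beta> x = - \<beta> * x - of_int \<lfloor>- \<beta> * x + \<beta> / (\<beta> + 1)\<rfloor>"

(* The digit y_i of d_{-\<beta>}(y); meaningful for y in I and i \<ge> 1. *)
definition d_neg :: "real \<Rightarrow> real \<Rightarrow> nat \<Rightarrow> int" where
  "d_neg \<beta> y i = \<lfloor>- \<beta> * (T_neg \<beta> ^^ (i - 1)) y + \<beta> / (\<beta> + 1)\<rfloor>"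

(* The open interval, i.e. I without its left endpoint, is intended.  For \<beta> > 1 it is
   a neighbourhood of 0, so a suitable j always exists. *)
definition shift_neg :: "real \<Rightarrow> real \<Rightarrow> nat" where
  "shift_neg \<beta> x =
     (LEAST j. x / (- \<beta>) ^ j \<in> {- \<beta> / (\<beta> + 1) <..< 1 / (\<beta> + 1)})"

(* The coefficient of (-\<beta>)^k in the expansion x = (\<Sum>i\<ge>1. y_i (-\<beta>)^(j - i)),
   that is, y_i for i = j - k. *)
definition coeff_neg :: "real \<Rightarrow> real \<Rightarrow> int \<Rightarrow> int" where
  "coeff_neg \<beta> x k =
     (let j = shift_neg \<beta> x; y = x / (- \<beta>) ^ j
      in if k < int j then d_neg \<beta> y (nat (int j - k)) else 0)"

definition Fin_neg :: "real \<Rightarrow> real set" where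
  "Fin_neg \<beta> = {x. finite {k. coeff_neg \<beta> x k \<noteq> 0}}"

definition Z_neg :: "real \<Rightarrow> real set" where
  "Z_neg \<beta> = {x. \<forall>k<0. coeff_neg \<beta> x k = 0}"

definition scaled_Z_neg :: "real \<Rightarrow> nat \<Rightarrow> real set" where
  "scaled_Z_neg \<beta> l = (\<lambda>z. z / (- \<beta>) ^ l) ` Z_neg \<beta>"

(* The minimum is taken in enat, so that it is \<infinity> if no l qualifies; a finite value
   thus says that the minimum exists and is attained. *)
definition L_oplus :: "real \<Rightarrow> enat" where
  "L_oplus \<beta> = Inf (enat ` {l. \<forall>x\<in>Z_neg \<beta>. \<forall>y\<in>Z_neg \<beta>.
     x + y \<in> Fin_neg \<beta> \<longrightarrow> x + y \<in> scaled_Z_neg \<beta> l})"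

definition L_otimes :: "real \<Rightarrow> enat" where
  "L_otimes \<beta> = Inf (enat ` {l. \<forall>x\<in>Z_neg \<beta>. \<forall>y\<in>Z_neg \<beta>.
     x * y \<in> Fin_neg \<beta> \<longrightarrow> x * y \<in> scaled_Z_neg \<beta> l})"

end

theory Submission
  imports Defs
begin

text \<open>
  Conjugation in \<open>\<int>[\<beta>]\<close> sends \<open>\<beta>\<close> to \<open>- 1 / \<beta>\<close>, hence \<open>- \<beta>\<close> to \<open>1 / \<beta>\<close>. All digits lie in
  \<open>{0..m}\<close>, and the digit preceding a remainder \<open>0\<close> is at most \<open>m - 1\<close>; so the conjugate of a
  \<open>(- \<beta>)\<close>-integer lies in \<open>[0, m - 1 + m / (\<beta> - 1)) = [0, \<beta>)\<close>. A number with exactly \<open>l \<ge> 1\<close>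
  fractional digits has conjugate at least \<open>\<beta> ^ l\<close>. Sums and products of two integers have
  conjugate below \<open>\<beta>\<^sup>2\<close> (as \<open>2 \<le> \<beta>\<close>), which forces \<open>l \<le> 1\<close>. Conversely \<open>m\<close> and \<open>2\<close> are
  \<open>(- \<beta>)\<close>-integers, whereas \<open>2m = m + m = 2 \<cdot> m\<close> has the expansion \<open>1 (m-1) (m-1) \<bullet> 1\<close>; it is no
  \<open>(- \<beta>)\<close>-integer, being its own conjugate and larger than \<open>\<beta>\<close>.
\<close>

section \<open>The transformation and its digits\<close>

abbreviation I_neg :: "real \<Rightarrow> real set" where
  "I_neg \<beta> \<equiv> {- \<beta> / (\<beta> + 1) ..< 1 / (\<beta> + 1)}"

abbreviation J_neg :: "real \<Rightarrow> real set" where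
  "J_neg \<beta> \<equiv> {- \<beta> / (\<beta> + 1) <..< 1 / (\<beta> + 1)}"

lemma I_neg_length:
  fixes \<beta> :: real
  assumes "\<beta> > 1"
  shows "1 / (\<beta> + 1) = 1 - \<beta> / (\<beta> + 1)"
  using assms by (simp add: field_simps)

lemma floor_I_neg:
  fixes d :: int
  assumes "\<beta> > 1" "t - of_int d \<in> I_neg \<beta>"
  shows "\<lfloor>t + \<beta> / (\<beta> + 1)\<rfloor> = d"
  using assms(2) I_neg_length[OF assms(1)] by (intro floor_unique) auto

text \<open>As \<open>I_neg\<close> is half-open of length 1, the digit is the only integer that
  puts the remainder into it; orbits can therefore be computed by guessing digits.\<close>

lemma T_neg_eqI:
  fixes d :: int
  assumes "\<beta> > 1" "- \<beta> * x - of_int d = t" "t \<in> I_neg \<beta>"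
  shows "T_neg \<beta> x = t"
  using floor_I_neg[OF assms(1), of "- \<beta> * x" d] assms by (simp add: T_neg_def)

lemma T_neg_mem:
  assumes "\<beta> > 1"
  shows "T_neg \<beta> x \<in> I_neg \<beta>"
  using I_neg_length[OF assms] floor_correct[of "- \<beta> * x + \<beta> / (\<beta> + 1)"]
  unfolding T_neg_def atLeastLessThan_iff minus_divide_left[symmetric] by linarith

lemma zero_mem_J_neg:
  fixes \<beta> :: real
  assumes "\<beta> > 1"
  shows "0 \<in> J_neg \<beta>"
  using assms by (auto simp: field_simps)

lemma T_neg_0:
  assumes "\<beta> > 1"
  shows "T_neg \<beta> 0 = 0"
  using zero_mem_J_neg[OF assms] by (intro T_neg_eqI[OF assms, of 0 0]) auto

lemma T_neg_iter_mem:
  assumes "\<beta> > 1" "w \<in> I_neg \<beta>"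
  shows "(T_neg \<beta> ^^ n) w \<in> I_neg \<beta>"
proof (cases n)
  case 0
  then show ?thesis using assms(2) by simp
next
  case (Suc k)
  then show ?thesis using T_neg_mem[OF assms(1)] by simp
qed

lemma T_neg_iter_zero_mono:
  assumes "\<beta> > 1" "(T_neg \<beta> ^^ n) w = 0" "n \<le> k"
  shows "(T_neg \<beta> ^^ k) w = 0"
  using assms(3,2) by (induction k rule: dec_induct) (simp_all add: T_neg_0[OF assms(1)])

lemma T_neg_iter_Suc:
  "(T_neg \<beta> ^^ Suc n) w = - \<beta> * (T_neg \<beta> ^^ n) w - of_int (d_neg \<beta> w (Suc n))"
  by (simp add: T_neg_def d_neg_def)

text \<open>Zero is a fixed point of \<open>T_neg\<close>. Conversely, along zero digits
  \<open>T_neg\<close> multiplies by \<open>- \<beta>\<close>, which would drive a non-zero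
  remainder out of the bounded interval.\<close>

lemma T_neg_iter_eq_0_iff:
  assumes "\<beta> > 1" "w \<in> I_neg \<beta>"
  shows "(T_neg \<beta> ^^ n) w = 0 \<longleftrightarrow> (\<forall>i>n. d_neg \<beta> w i = 0)"
proof
  assume z: "(T_neg \<beta> ^^ n) w = 0"
  show "\<forall>i>n. d_neg \<beta> w i = 0"
  proof (intro allI impI)
    fix i assume "n < i"
    then obtain k where k: "i = Suc k" "n \<le> k" by (cases i) auto
    have "(T_neg \<beta> ^^ k) w = 0" "(T_neg \<beta> ^^ Suc k) w = 0"
      using T_neg_iter_zero_mono[OF assms(1) z] k(2) by (auto simp del: funpow.simps)
    then show "d_neg \<beta> w i = 0"
      using T_neg_iter_Suc[of k \<beta> w] k(1) by (simp del: funpow.simps)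
  qed
next
  assume d: "\<forall>i>n. d_neg \<beta> w i = 0"
  have iter: "(T_neg \<beta> ^^ (n + k)) w = (- \<beta>) ^ k * (T_neg \<beta> ^^ n) w" for k
  proof (induction k)
    case (Suc k)
    then show ?case
      using T_neg_iter_Suc[of "n + k" \<beta> w] d by simp
  qed simp
  have bound: "\<bar>t\<bar> \<le> 1" if "t \<in> I_neg \<beta>" for t
  proof -
    have "\<beta> / (\<beta> + 1) \<le> 1" "1 / (\<beta> + 1) \<le> 1" using assms(1) by auto
    then show ?thesis using that by (auto simp: abs_le_iff)
  qed
  show "(T_neg \<beta> ^^ n) w = 0"
  proof (rule ccontr)
    assume nz: "(T_neg \<beta> ^^ n) w \<noteq> 0"
    obtain k where k: "1 / \<bar>(T_neg \<beta> ^^ n) w\<bar> < \<beta> ^ k"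
      using real_arch_pow[OF assms(1)] by blast
    then have "1 < \<beta> ^ k * \<bar>(T_neg \<beta> ^^ n) w\<bar>"
      using nz by (simp add: field_simps)
    also have "\<dots> = \<bar>(T_neg \<beta> ^^ (n + k)) w\<bar>"
      using assms(1) by (simp add: iter abs_mult power_abs)
    also have "\<dots> \<le> 1"
      using bound T_neg_iter_mem[OF assms] by blast
    finally show False by simp
  qed
qed

section \<open>Expansions and scaling\<close>

text \<open>The excluded left endpoint matters: division by \<open>- \<beta>\<close> would carry it
  to \<open>1 / (\<beta> + 1)\<close>, outside the interval.\<close>

lemma J_neg_scale:
  assumes "\<beta> > 1" "w \<in> J_neg \<beta>"
  shows "w / (- \<beta>) \<in> J_neg \<beta>"
proof -
  have w: "- \<beta> < w * (\<beta> + 1)" "w * (\<beta> + 1) < 1"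
    using assms by (auto simp: field_simps)
  have "1 < \<beta> * \<beta>" using assms(1) by (simp add: less_1_mult)
  with w have "w * (\<beta> + 1) < \<beta> * \<beta>" by linarith
  with w(1) assms(1) show ?thesis by (auto simp: field_simps)
qed

lemma T_neg_J_neg_scale:
  assumes "\<beta> > 1" "w \<in> J_neg \<beta>"
  shows "T_neg \<beta> (w / (- \<beta>)) = w"
  using assms by (intro T_neg_eqI[of _ _ 0]) auto

text \<open>The first digit vanishes because \<open>w\<close> already lies in the interval, and one
  step of \<open>T_neg\<close> then returns to \<open>w\<close>.\<close>

lemma d_neg_J_neg_scale:
  assumes "\<beta> > 1" "w \<in> J_neg \<beta>" "i \<ge> 1"
  shows "d_neg \<beta> (w / (- \<beta>)) i = (if i = 1 then 0 else d_neg \<beta> w (i - 1))"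
proof (cases "i = 1")
  case True
  then show ?thesis
    using floor_I_neg[OF assms(1), of w 0] assms by (simp add: d_neg_def)
next
  case False
  define k where "k = i - 2"
  have k: "i = Suc (Suc k)" using False assms(3) by (simp add: k_def)
  have "(T_neg \<beta> ^^ Suc k) (w / (- \<beta>)) = (T_neg \<beta> ^^ k) w"
    unfolding funpow_Suc_right o_apply T_neg_J_neg_scale[OF assms(1,2)] ..
  then show ?thesis using k by (simp add: d_neg_def del: funpow.simps)
qed

lemma ex_scale_J_neg:
  assumes "\<beta> > 1"
  shows "\<exists>n. z / (- \<beta>) ^ n \<in> J_neg \<beta>"
proof -
  obtain n where n: "\<bar>z\<bar> * (\<beta> + 1) < \<beta> ^ n"
    using real_arch_pow[OF assms] by blast
  then have "\<bar>z / (- \<beta>) ^ n\<bar> < 1 / (\<beta> + 1)"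
    using assms by (simp add: power_abs field_simps)
  moreover have "1 / (\<beta> + 1) \<le> \<beta> / (\<beta> + 1)"
    using assms by (simp add: divide_right_mono)
  ultimately show ?thesis
    unfolding greaterThanLessThan_iff minus_divide_left[symmetric] abs_less_iff
    by (intro exI[of _ n]) linarith
qed

lemma shift_neg_mem:
  assumes "\<beta> > 1"
  shows "z / (- \<beta>) ^ shift_neg \<beta> z \<in> J_neg \<beta>"
  unfolding shift_neg_def using ex_scale_J_neg[OF assms] by (rule LeastI_ex)

text \<open>The minimality of the shift is immaterial: a larger one only adds leading zeros.\<close>

lemma coeff_neg_eq:
  assumes "\<beta> > 1" "z / (- \<beta>) ^ n \<in> J_neg \<beta>"
  shows "coeff_neg \<beta> z k = (if k < int n then d_neg \<beta> (z / (- \<beta>) ^ n) (nat (int n - k)) else 0)"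
proof -
  let ?s = "shift_neg \<beta> z"
  have le: "?s \<le> n"
    unfolding shift_neg_def using assms(2) by (rule Least_le)
  show ?thesis using le
  proof (induction n rule: dec_induct)
    case base
    then show ?case by (simp add: coeff_neg_def Let_def)
  next
    case (step r)
    have mem: "z / (- \<beta>) ^ r \<in> J_neg \<beta>"
      using step(1)
    proof (induction r rule: dec_induct)
      case base
      show ?case by (rule shift_neg_mem[OF assms(1)])
    next
      case (step q)
      then show ?case using J_neg_scale[OF assms(1) step(3)] by (simp add: mult.commute)
    qed
    have "z / (- \<beta>) ^ Suc r = z / (- \<beta>) ^ r / (- \<beta>)"
      by (simp add: mult.commute)
    \<comment> \<open>For \<open>k = int r\<close> the digit index is 1, and the prepended zero
      agrees with the default 0 for exponent \<open>r\<close>; larger indices drop by one.\<close>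
    moreover have "nat (1 + int r - k) - 1 = nat (int r - k)" by simp
    ultimately show ?case
      using d_neg_J_neg_scale[OF assms(1) mem, of "nat (int (Suc r) - k)"] step(3)
      by (auto simp: algebra_simps)
  qed
qed

text \<open>Digit \<open>i\<close> belongs to the power \<open>n - i\<close>, so the negative powers
  are the indices beyond \<open>n\<close>, and one vanishing remainder accounts for all of
  them.\<close>

lemma Z_neg_iff:
  assumes "\<beta> > 1" "z / (- \<beta>) ^ n \<in> J_neg \<beta>"
  shows "z \<in> Z_neg \<beta> \<longleftrightarrow> (T_neg \<beta> ^^ n) (z / (- \<beta>) ^ n) = 0"
proof -
  let ?w = "z / (- \<beta>) ^ n"
  have "z \<in> Z_neg \<beta> \<longleftrightarrow> (\<forall>k<0. d_neg \<beta> ?w (nat (int n - k)) = 0)"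
    by (auto simp: Z_neg_def coeff_neg_eq[OF assms])
  also have "\<dots> \<longleftrightarrow> (\<forall>i>n. d_neg \<beta> ?w i = 0)"
  proof (intro iffI allI impI)
    fix i assume *: "\<forall>k<0. d_neg \<beta> ?w (nat (int n - k)) = 0" "n < i"
    show "d_neg \<beta> ?w i = 0"
      using spec[OF *(1), of "int n - int i"] *(2) by simp
  qed simp
  also have "\<dots> \<longleftrightarrow> (T_neg \<beta> ^^ n) ?w = 0"
    using T_neg_iter_eq_0_iff[OF assms(1), of ?w n] assms(2) by simp
  finally show ?thesis .
qed

text \<open>The same point of the interval represents \<open>z\<close> with exponent
  \<open>n\<close> and \<open>z * (- \<beta>) ^ l\<close> with exponent
  \<open>n + l\<close>.\<close>

lemma scaled_Z_neg_iff:
  assumes "\<beta> > 1" "z / (- \<beta>) ^ n \<in> J_neg \<beta>"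
  shows "z \<in> scaled_Z_neg \<beta> l \<longleftrightarrow> (T_neg \<beta> ^^ (n + l)) (z / (- \<beta>) ^ n) = 0"
proof -
  have "z * (- \<beta>) ^ l / (- \<beta>) ^ (n + l) = z / (- \<beta>) ^ n"
    using assms(1) by (simp add: power_add)
  moreover have "z \<in> scaled_Z_neg \<beta> l \<longleftrightarrow> z * (- \<beta>) ^ l \<in> Z_neg \<beta>"
    using assms(1) by (force simp: scaled_Z_neg_def image_iff field_simps)
  ultimately show ?thesis
    using Z_neg_iff[OF assms(1), of "z * (- \<beta>) ^ l" "n + l"] assms(2) by simp
qed

lemma Fin_neg_iff:
  assumes "\<beta> > 1" "z / (- \<beta>) ^ n \<in> J_neg \<beta>"
  shows "z \<in> Fin_neg \<beta> \<longleftrightarrow> (\<exists>N. (T_neg \<beta> ^^ N) (z / (- \<beta>) ^ n) = 0)"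
proof -
  let ?w = "z / (- \<beta>) ^ n"
  let ?K = "{k. coeff_neg \<beta> z k \<noteq> 0}"
  have "finite ?K \<longleftrightarrow> (\<exists>N. \<forall>i>N. d_neg \<beta> ?w i = 0)"
  proof
    assume "finite ?K"
    then have "finite ((\<lambda>k. nat (int n - k)) ` ?K)" by (rule finite_imageI)
    then obtain N where N: "\<forall>i \<in> (\<lambda>k. nat (int n - k)) ` ?K. i \<le> N"
      using finite_nat_set_iff_bounded_le by blast
    have "d_neg \<beta> ?w i = 0" if "N < i" for i
    proof (rule ccontr)
      assume "d_neg \<beta> ?w i \<noteq> 0"
      then have "int n - int i \<in> ?K"
        using that by (simp add: coeff_neg_eq[OF assms])
      then have "nat (int n - (int n - int i)) \<le> N" using N by blast
      with that show False by simp
    qed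
    then show "\<exists>N. \<forall>i>N. d_neg \<beta> ?w i = 0" by blast
  next
    assume "\<exists>N. \<forall>i>N. d_neg \<beta> ?w i = 0"
    then obtain N where N: "\<forall>i>N. d_neg \<beta> ?w i = 0" by blast
    \<comment> \<open>From the power \<open>n\<close> upwards the coefficients are 0 by default; the
      bound \<open>N\<close> on the digit indices limits the powers from below.\<close>
    have "?K \<subseteq> {int n - int N..int n}"
    proof
      fix k assume k: "k \<in> ?K"
      then have "k < int n" "d_neg \<beta> ?w (nat (int n - k)) \<noteq> 0"
        by (auto simp: coeff_neg_eq[OF assms] split: if_splits)
      then have "\<not> N < nat (int n - k)" using N by blast
      with \<open>k < int n\<close> show "k \<in> {int n - int N..int n}" by auto
    qed
    then show "finite ?K" by (rule finite_subset) simp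
  qed
  then show ?thesis
    using T_neg_iter_eq_0_iff[OF assms(1), of ?w] assms(2) by (simp add: Fin_neg_def)
qed

section \<open>Conjugates\<close>

locale quadratic_unit =
  fixes m :: int and \<beta> :: real
  assumes m_ge_2: "m \<ge> 2" and beta_gt_1: "\<beta> > 1" and beta_sq: "\<beta>\<^sup>2 = of_int m * \<beta> + 1"
begin

section \<open>Size and irrationality of \<beta>\<close>

lemma beta_eq: "\<beta> = of_int m + 1 / \<beta>"
  using beta_sq beta_gt_1 by (simp add: field_simps power2_eq_square)

lemma beta_gt_m: "of_int m < \<beta>"
  using beta_eq beta_gt_1 by (smt (verit) divide_pos_pos)

lemma beta_less: "\<beta> < of_int m + 1"
  using beta_eq beta_gt_1 by (smt (verit) divide_less_eq_1)

lemma beta_gt_2: "2 < \<beta>"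
  using beta_gt_m m_ge_2 by linarith

lemma beta_mult: "\<beta> * \<beta> = of_int m * \<beta> + 1"
  using beta_sq by (simp add: power2_eq_square)

text \<open>Descent: if \<open>q\<close> and \<open>q\<beta>\<close> are integers, so are \<open>q(\<beta> - m) = q / \<beta> < q\<close> and its \<open>\<beta>\<close>-multiple \<open>q\<close>.\<close>

lemma no_int_multiple:
  fixes q :: nat and p :: int
  assumes "q > 0"
  shows "of_nat q * \<beta> \<noteq> of_int p"
  using assms
proof (induction q arbitrary: p rule: less_induct)
  case (less q)
  show ?case
  proof
    assume eq: "of_nat q * \<beta> = of_int p"
    define r where "r = p - int q * m"
    have r: "of_int r = of_nat q / \<beta>"
    proof -
      have "of_int r = of_nat q * (\<beta> - of_int m)"
        using eq by (simp add: r_def algebra_simps)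
      also have "\<beta> - of_int m = 1 / \<beta>" using beta_eq by linarith
      finally show ?thesis by simp
    qed
    have "0 < real_of_int r" "real_of_int r < of_nat q"
      using less.prems beta_gt_1 by (simp_all add: r field_simps)
    then have "0 < nat r" "nat r < q" by simp_all
    moreover have "of_nat (nat r) * \<beta> = of_int (int q)"
      using \<open>0 < nat r\<close> r beta_gt_1 by simp
    ultimately show False using less.IH by blast
  qed
qed

text \<open>Irrationality as linear independence of 1 and \<beta> over the integers, which makes
  conjugates unique.\<close>

lemma int_combination_eq_0:
  fixes a b :: int
  assumes "of_int a + of_int b * \<beta> = 0"
  shows "a = 0 \<and> b = 0"
proof (rule ccontr)
  assume "\<not> ?thesis"
  with assms have b: "b \<noteq> 0" by auto
  have "of_nat (nat \<bar>b\<bar>) * \<beta> = of_int (- (sgn b * a))"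
  proof -
    have "of_nat (nat \<bar>b\<bar>) * \<beta> = of_int (sgn b) * (of_int b * \<beta>)"
      by (cases "b > 0") (use b in auto)
    also have "of_int b * \<beta> = - of_int a" using assms by linarith
    finally show ?thesis by simp
  qed
  with no_int_multiple b show False by (metis zero_less_abs_iff zero_less_nat_eq)
qed

text \<open>Conjugation as a relation on the reals: it is defined only on \<int>[\<beta>], and
  \<open>- 1 / \<beta>\<close> is the other root of \<open>t\<^sup>2 = m * t + 1\<close>.\<close>

definition conj_rel :: "real \<Rightarrow> real \<Rightarrow> bool" where
  "conj_rel x c \<longleftrightarrow> (\<exists>a b :: int. x = of_int a + of_int b * \<beta> \<and> c = of_int a - of_int b / \<beta>)"

lemma conj_rel_unique:
  assumes "conj_rel x c" "conj_rel x c'"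
  shows "c = c'"
proof -
  obtain a b a' b' where *: "x = of_int a + of_int b * \<beta>" "c = of_int a - of_int b / \<beta>"
      "x = of_int a' + of_int b' * \<beta>" "c' = of_int a' - of_int b' / \<beta>"
    using assms unfolding conj_rel_def by blast
  have "of_int (a - a') + of_int (b - b') * \<beta> = 0"
    using *(1,3) by (simp add: algebra_simps)
  then have "a = a'" "b = b'" using int_combination_eq_0 by fastforce+
  with * show ?thesis by simp
qed

lemma conj_rel_int: "conj_rel (of_int k) (of_int k)"
  unfolding conj_rel_def by (intro exI[of _ k] exI[of _ 0]) simp

lemma conj_rel_add:
  assumes "conj_rel x c" "conj_rel y d"
  shows "conj_rel (x + y) (c + d)"
proof -
  obtain a b a' b' where *: "x = of_int a + of_int b * \<beta>" "c = of_int a - of_int b / \<beta>"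
      "y = of_int a' + of_int b' * \<beta>" "d = of_int a' - of_int b' / \<beta>"
    using assms unfolding conj_rel_def by blast
  show ?thesis unfolding conj_rel_def
    by (intro exI[of _ "a + a'"] exI[of _ "b + b'"]) (simp add: * algebra_simps add_divide_distrib)
qed

lemma conj_rel_mult:
  assumes "conj_rel x c" "conj_rel y d"
  shows "conj_rel (x * y) (c * d)"
proof -
  obtain a b a' b' where *: "x = of_int a + of_int b * \<beta>" "c = of_int a - of_int b / \<beta>"
      "y = of_int a' + of_int b' * \<beta>" "d = of_int a' - of_int b' / \<beta>"
    using assms unfolding conj_rel_def by blast
  \<comment> \<open>Since \<open>- u\<close> satisfies the same quadratic equation as \<beta>, both
    products reduce to the same integer coordinates.\<close>
  define u where "u = 1 / \<beta>"
  have u: "u * u = 1 - of_int m * u"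
  proof -
    have "u = \<beta> - of_int m" using beta_eq unfolding u_def by linarith
    then have "u * u = u * (\<beta> - of_int m)" by (rule arg_cong[where f = "\<lambda>t. u * t"])
    moreover have "u * \<beta> = 1" using beta_gt_1 by (simp add: u_def)
    ultimately show ?thesis by (simp add: algebra_simps)
  qed
  have "x * y = of_int a * of_int a' + (of_int a * of_int b' + of_int a' * of_int b) * \<beta>
      + of_int b * of_int b' * (\<beta> * \<beta>)"
    by (simp add: * algebra_simps)
  then have 1: "x * y = of_int (a * a' + b * b') + of_int (a * b' + a' * b + m * b * b') * \<beta>"
    by (simp add: beta_mult algebra_simps)
  have "c * d = (of_int a - of_int b * u) * (of_int a' - of_int b' * u)"
    by (simp add: * u_def)
  also have "\<dots> = of_int a * of_int a' - (of_int a * of_int b' + of_int a' * of_int b) * u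
      + of_int b * of_int b' * (u * u)"
    by (simp add: algebra_simps)
  finally have 2: "c * d = of_int (a * a' + b * b') - of_int (a * b' + a' * b + m * b * b') * u"
    by (simp add: u algebra_simps)
  show ?thesis unfolding conj_rel_def
    by (intro exI[of _ "a * a' + b * b'"] exI[of _ "a * b' + a' * b + m * b * b'"])
      (use 1 2 in \<open>simp add: u_def\<close>)
qed

lemma conj_rel_neg_beta: "conj_rel (- \<beta>) (1 / \<beta>)"
  unfolding conj_rel_def by (intro exI[of _ 0] exI[of _ "-1"]) simp

lemma conj_rel_neg_beta_power: "conj_rel ((- \<beta>) ^ n) (1 / \<beta> ^ n)"
proof (induction n)
  case 0
  then show ?case using conj_rel_int[of 1] by simp
next
  case (Suc n)
  then show ?case using conj_rel_mult[OF conj_rel_neg_beta Suc] by simp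
qed

section \<open>Digit bounds and conjugates of expansions\<close>

lemma d_neg_bounds:
  assumes "w \<in> I_neg \<beta>"
  shows "0 \<le> d_neg \<beta> w (Suc n)" "d_neg \<beta> w (Suc n) \<le> m"
proof -
  let ?t = "(T_neg \<beta> ^^ n) w"
  \<comment> \<open>These bounds place the argument of the floor in \<open>(0, \<beta>]\<close>, and
    \<open>\<beta> < m + 1\<close>.\<close>
  have t: "- \<beta> \<le> ?t * (\<beta> + 1)" "?t * (\<beta> + 1) < 1"
    using T_neg_iter_mem[OF beta_gt_1 assms, of n] beta_gt_1 by (auto simp: field_simps)
  have "\<beta> * (?t * (\<beta> + 1)) \<le> \<beta> * 1"
    using t(2) beta_gt_1 by (intro mult_left_mono) auto
  then have "0 \<le> - \<beta> * ?t + \<beta> / (\<beta> + 1)"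
    using beta_gt_1 by (simp add: field_simps)
  then show "0 \<le> d_neg \<beta> w (Suc n)" by (simp add: d_neg_def)
  have "\<beta> * - \<beta> \<le> \<beta> * (?t * (\<beta> + 1))"
    using t(1) beta_gt_1 by (intro mult_left_mono) auto
  then have "- \<beta> * ?t + \<beta> / (\<beta> + 1) \<le> \<beta>"
    using beta_gt_1 by (simp add: field_simps)
  then have "- \<beta> * ?t + \<beta> / (\<beta> + 1) < of_int (m + 1)"
    using beta_less by simp
  then show "d_neg \<beta> w (Suc n) \<le> m"
    unfolding d_neg_def diff_Suc_1 by (simp only: floor_less_iff[symmetric])
qed

text \<open>With remainder 0 the digit is exactly \<open>- \<beta>\<close> times the previous
  remainder, hence at most \<open>\<beta>\<^sup>2 / (\<beta> + 1)\<close>, which is below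
  \<open>m\<close> because \<open>m * \<beta> + 1 < m * \<beta> + m\<close>.\<close>

lemma d_neg_before_zero:
  assumes "w \<in> I_neg \<beta>" "(T_neg \<beta> ^^ Suc n) w = 0"
  shows "d_neg \<beta> w (Suc n) \<le> m - 1"
proof -
  let ?t = "(T_neg \<beta> ^^ n) w"
  have d: "of_int (d_neg \<beta> w (Suc n)) = - \<beta> * ?t"
    using T_neg_iter_Suc[of n \<beta> w] assms(2) by linarith
  have t: "- \<beta> \<le> ?t * (\<beta> + 1)"
    using T_neg_iter_mem[OF beta_gt_1 assms(1), of n] beta_gt_1 by (auto simp: field_simps)
  have "\<beta> * - \<beta> \<le> \<beta> * (?t * (\<beta> + 1))"
    using t beta_gt_1 by (intro mult_left_mono) auto
  then have "of_int (d_neg \<beta> w (Suc n)) * (\<beta> + 1) \<le> \<beta> * \<beta>"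
    unfolding d by (simp add: algebra_simps)
  also have "\<dots> < of_int m * (\<beta> + 1)"
    using beta_mult m_ge_2 by (simp add: algebra_simps)
  finally have "real_of_int (d_neg \<beta> w (Suc n)) < of_int m"
    using beta_gt_1 by simp
  then show ?thesis by simp
qed

text \<open>The difference is the value of the first \<open>N\<close> digits read as an integer
  part, so it lies in \<int>[\<beta>] even if \<open>w\<close> does not. Its conjugate is a sum of
  digits times powers of \<open>1 / \<beta>\<close>; the upper bound is the full geometric series
  with digit \<open>m\<close>, the fixed point of
  \<open>c \<mapsto> c / \<beta> + m\<close>.\<close>

lemma conj_rel_prefix:
  assumes "w \<in> I_neg \<beta>"
  shows "\<exists>c. conj_rel ((- \<beta>) ^ N * w - (T_neg \<beta> ^^ N) w) c \<and> 0 \<le> c \<and> c < of_int m * \<beta> / (\<beta> - 1)"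
proof (induction N)
  case 0
  have "0 < of_int m * \<beta> / (\<beta> - 1)" using m_ge_2 beta_gt_1 by simp
  then show ?case using conj_rel_int[of 0] by auto
next
  case (Suc N)
  then obtain c where c: "conj_rel ((- \<beta>) ^ N * w - (T_neg \<beta> ^^ N) w) c" "0 \<le> c"
      "c < of_int m * \<beta> / (\<beta> - 1)" by blast
  let ?d = "d_neg \<beta> w (Suc N)"
  have "conj_rel (- \<beta> * ((- \<beta>) ^ N * w - (T_neg \<beta> ^^ N) w) + of_int ?d) (1 / \<beta> * c + of_int ?d)"
    by (intro conj_rel_add conj_rel_mult conj_rel_neg_beta conj_rel_int c(1))
  moreover have "- \<beta> * ((- \<beta>) ^ N * w - (T_neg \<beta> ^^ N) w) + of_int ?d
      = (- \<beta>) ^ Suc N * w - (T_neg \<beta> ^^ Suc N) w"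
    unfolding T_neg_iter_Suc by (simp add: algebra_simps)
  moreover have "0 \<le> 1 / \<beta> * c + of_int ?d"
    using c(2) d_neg_bounds(1)[OF assms] beta_gt_1 by simp
  moreover have "1 / \<beta> * c + of_int ?d < of_int m * \<beta> / (\<beta> - 1)"
  proof -
    have "1 / \<beta> * c < 1 / \<beta> * (of_int m * \<beta> / (\<beta> - 1))"
      using c(3) beta_gt_1 by (intro mult_strict_left_mono) auto
    also have "\<dots> = of_int m * \<beta> / (\<beta> - 1) - of_int m"
      using beta_gt_1 by (simp add: field_simps)
    finally show ?thesis using d_neg_bounds(2)[OF assms, of N] by simp
  qed
  ultimately show ?case by (metis (no_types, lifting))
qed

text \<open>Splitting off the last digit, the earlier ones contribute between 0 and
  \<open>m / (\<beta> - 1) = \<beta> - (m - 1)\<close> to the conjugate, and the last one at most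
  \<open>m - 1\<close>.\<close>

lemma conj_rel_terminating:
  assumes "w \<in> I_neg \<beta>" "(T_neg \<beta> ^^ Suc N) w = 0"
  shows "\<exists>c. conj_rel ((- \<beta>) ^ Suc N * w) c \<and> of_int (d_neg \<beta> w (Suc N)) \<le> c \<and> c < \<beta>"
proof -
  obtain c where c: "conj_rel ((- \<beta>) ^ N * w - (T_neg \<beta> ^^ N) w) c" "0 \<le> c"
      "c < of_int m * \<beta> / (\<beta> - 1)"
    using conj_rel_prefix[OF assms(1)] by blast
  let ?d = "d_neg \<beta> w (Suc N)"
  have "conj_rel (- \<beta> * ((- \<beta>) ^ N * w - (T_neg \<beta> ^^ N) w) + of_int ?d) (1 / \<beta> * c + of_int ?d)"
    by (intro conj_rel_add conj_rel_mult conj_rel_neg_beta conj_rel_int c(1))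
  moreover have "- \<beta> * ((- \<beta>) ^ N * w - (T_neg \<beta> ^^ N) w) + of_int ?d = (- \<beta>) ^ Suc N * w"
    using T_neg_iter_Suc[of N \<beta> w] unfolding assms(2) by (simp add: algebra_simps)
  moreover have "of_int ?d \<le> 1 / \<beta> * c + of_int ?d"
    using c(2) beta_gt_1 by simp
  moreover have "1 / \<beta> * c + of_int ?d < \<beta>"
  proof -
    have "1 / \<beta> * c < 1 / \<beta> * (of_int m * \<beta> / (\<beta> - 1))"
      using c(3) beta_gt_1 by (intro mult_strict_left_mono) auto
    also have "\<dots> = \<beta> - (of_int m - 1)"
      using beta_gt_1 beta_mult by (simp add: field_simps)
    finally show ?thesis using d_neg_before_zero[OF assms] by linarith
  qed
  ultimately show ?thesis by (metis (no_types, lifting))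
qed

lemma conj_rel_Z_neg:
  assumes "x \<in> Z_neg \<beta>"
  obtains c where "conj_rel x c" "0 \<le> c" "c < \<beta>"
proof -
  obtain n where n: "x / (- \<beta>) ^ n \<in> J_neg \<beta>"
    using ex_scale_J_neg[OF beta_gt_1] by blast
  let ?w = "x / (- \<beta>) ^ n"
  have w: "?w \<in> I_neg \<beta>" using n by simp
  have z: "(T_neg \<beta> ^^ n) ?w = 0"
    using Z_neg_iff[OF beta_gt_1 n] assms by simp
  have x: "(- \<beta>) ^ n * ?w = x" using beta_gt_1 by simp
  show ?thesis
  proof (cases n)
    \<comment> \<open>There is no last digit to split off, but the point is then \<open>x\<close>
      itself.\<close>
    case 0
    then have "x = 0" using z by simp
    then show ?thesis using that[of 0] conj_rel_int[of 0] beta_gt_1 by simp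
  next
    case (Suc N)
    then obtain c where "conj_rel x c" "of_int (d_neg \<beta> ?w (Suc N)) \<le> c" "c < \<beta>"
      using conj_rel_terminating[OF w, of N] z x by metis
    moreover have "0 \<le> real_of_int (d_neg \<beta> ?w (Suc N))"
      using d_neg_bounds(1)[OF w] by simp
    ultimately show ?thesis using that by fastforce
  qed
qed

lemma Fin_neg_conj_less:
  assumes "z \<in> Fin_neg \<beta>" "conj_rel z c" "c < \<beta>\<^sup>2"
  shows "z \<in> scaled_Z_neg \<beta> 1"
proof -
  obtain n where n: "z / (- \<beta>) ^ n \<in> J_neg \<beta>"
    using ex_scale_J_neg[OF beta_gt_1] by blast
  let ?w = "z / (- \<beta>) ^ n"
  have w: "?w \<in> I_neg \<beta>" using n by simp
  define N where "N = (LEAST N. (T_neg \<beta> ^^ N) ?w = 0)"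
  have ex: "\<exists>N. (T_neg \<beta> ^^ N) ?w = 0"
    using Fin_neg_iff[OF beta_gt_1 n] assms(1) by simp
  have N: "(T_neg \<beta> ^^ N) ?w = 0"
    unfolding N_def using ex by (rule LeastI_ex)
  have "N \<le> n + 1"
  proof (rule ccontr)
    assume "\<not> N \<le> n + 1"
    \<comment> \<open>There are \<open>r + 2\<close> fractional digits; the outer \<open>Suc\<close>
      exposes the last one.\<close>
    then obtain r where r: "N = Suc (n + Suc r)"
      using less_imp_Suc_add[of "n + 1" N] by auto
    let ?M = "n + Suc r"
    \<comment> \<open>By minimality of \<open>N\<close> the last remainder before 0 is non-zero, so
      the last digit is at least 1 and bounds the conjugate from below.\<close>
    have "(T_neg \<beta> ^^ ?M) ?w \<noteq> 0"
      using not_less_Least[of ?M "\<lambda>N. (T_neg \<beta> ^^ N) ?w = 0"] r unfolding N_def by linarith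
    then have "d_neg \<beta> ?w (Suc ?M) \<noteq> 0"
      using T_neg_iter_Suc[of ?M \<beta> ?w] N beta_gt_1 unfolding r by auto
    then have d: "1 \<le> d_neg \<beta> ?w (Suc ?M)"
      using d_neg_bounds(1)[OF w, of ?M] by linarith
    obtain e where e: "conj_rel ((- \<beta>) ^ N * ?w) e" "of_int (d_neg \<beta> ?w (Suc ?M)) \<le> e"
      using conj_rel_terminating[OF w, of ?M] N unfolding r by blast
    have eq: "(- \<beta>) ^ N * ?w = (- \<beta>) ^ (r + 2) * z"
      using beta_gt_1 by (simp add: r power_add)
    have "conj_rel ((- \<beta>) ^ (r + 2) * z) (1 / \<beta> ^ (r + 2) * c)"
      by (intro conj_rel_mult conj_rel_neg_beta_power assms(2))
    then have "e = 1 / \<beta> ^ (r + 2) * c"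
      using e(1) eq conj_rel_unique by metis
    then have "1 \<le> 1 / \<beta> ^ (r + 2) * c"
      using d e(2) by linarith
    then have "\<beta> ^ (r + 2) \<le> c"
      using beta_gt_1 by (simp add: field_simps)
    moreover have "\<beta>\<^sup>2 \<le> \<beta> ^ (r + 2)"
      using beta_gt_1 by (intro power_increasing) auto
    ultimately show False using assms(3) by linarith
  qed
  then show ?thesis
    using scaled_Z_neg_iff[OF beta_gt_1 n, of 1] T_neg_iter_zero_mono[OF beta_gt_1 N] by blast
qed

section \<open>Upper bounds for sums and products\<close>

lemma Z_neg_add_Fin_neg:
  assumes "x \<in> Z_neg \<beta>" "y \<in> Z_neg \<beta>" "x + y \<in> Fin_neg \<beta>"
  shows "x + y \<in> scaled_Z_neg \<beta> 1"
proof -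
  obtain c where c: "conj_rel x c" "0 \<le> c" "c < \<beta>" by (rule conj_rel_Z_neg[OF assms(1)])
  obtain d where d: "conj_rel y d" "0 \<le> d" "d < \<beta>" by (rule conj_rel_Z_neg[OF assms(2)])
  have "c + d < 2 * \<beta>" using c d by linarith
  \<comment> \<open>The condition \<open>m \<ge> 2\<close> enters here through
    \<open>2 < \<beta>\<close>.\<close>
  also have "\<dots> \<le> \<beta>\<^sup>2" using beta_gt_2 by (simp add: power2_eq_square)
  finally show ?thesis by (rule Fin_neg_conj_less[OF assms(3) conj_rel_add[OF c(1) d(1)]])
qed

lemma Z_neg_mult_Fin_neg:
  assumes "x \<in> Z_neg \<beta>" "y \<in> Z_neg \<beta>" "x * y \<in> Fin_neg \<beta>"
  shows "x * y \<in> scaled_Z_neg \<beta> 1"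
proof -
  obtain c where c: "conj_rel x c" "0 \<le> c" "c < \<beta>" by (rule conj_rel_Z_neg[OF assms(1)])
  obtain d where d: "conj_rel y d" "0 \<le> d" "d < \<beta>" by (rule conj_rel_Z_neg[OF assms(2)])
  have "c * d < \<beta>\<^sup>2"
    unfolding power2_eq_square using c d by (intro mult_strict_mono) auto
  then show ?thesis by (rule Fin_neg_conj_less[OF assms(3) conj_rel_mult[OF c(1) d(1)]])
qed

section \<open>The extremal example\<close>

lemma I_neg_frac_iff: "t \<in> I_neg \<beta> \<longleftrightarrow> - \<beta> \<le> t * (\<beta> + 1) \<and> t * (\<beta> + 1) < 1"
  using beta_gt_1 by (auto simp: field_simps)

lemma J_neg_frac_iff: "t \<in> J_neg \<beta> \<longleftrightarrow> - \<beta> < t * (\<beta> + 1) \<and> t * (\<beta> + 1) < 1"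
  using beta_gt_1 by (auto simp: field_simps)

text \<open>Powers of \<open>1 / \<beta>\<close> absorb \<open>m = \<beta> - 1 / \<beta>\<close>, so that all conditions below become linear in them.\<close>

lemma inverse_powers:
  obtains u where "\<beta> * u = 1" "\<beta> * u ^ 2 = u" "\<beta> * u ^ 3 = u ^ 2" "\<beta> * u ^ 4 = u ^ 3"
    and "of_int m = \<beta> - u" "of_int m * u ^ 3 = u ^ 2 - u ^ 4" "1 / \<beta> = u"
    and "0 < u" "u < 1 / 2" "0 < u ^ 4" "u ^ 4 \<le> u ^ 3" "u ^ 3 \<le> u ^ 2 / 2" "u ^ 2 \<le> u / 2"
proof -
  define u where "u = 1 / \<beta>"
  have bu: "\<beta> * u = 1" and u: "0 < u" "u < 1 / 2"
    using beta_gt_2 by (simp_all add: u_def field_simps)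
  have shift: "\<beta> * u ^ Suc k = u ^ k" for k
    using bu by (simp flip: mult.assoc)
  \<comment> \<open>Because \<open>u < 1 / 2\<close>, successive powers at least halve.\<close>
  have half: "u ^ Suc k \<le> u ^ k / 2" for k
    using mult_right_mono[of u "1 / 2" "u ^ k"] u by simp
  have "\<beta> * u ^ 2 = u" "\<beta> * u ^ 3 = u ^ 2" "\<beta> * u ^ 4 = u ^ 3"
    using shift[of 1] shift[of 2] shift[of 3] by (simp_all add: eval_nat_numeral)
  moreover have "u ^ 3 \<le> u ^ 2 / 2" "u ^ 2 \<le> u / 2"
    using half[of 2] half[of 1] by (simp_all add: eval_nat_numeral)
  moreover have "u ^ 4 \<le> u ^ 3" "0 < u ^ 4"
    using u by (auto intro: power_decreasing)
  moreover have m: "of_int m = \<beta> - u" using beta_eq unfolding u_def by linarith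
  moreover have "of_int m * u ^ 3 = u ^ 2 - u ^ 4"
    unfolding m using shift[of 2] by (simp add: left_diff_distrib eval_nat_numeral)
  ultimately show thesis using that[of u] bu u u_def by blast
qed

text \<open>The expansion of \<open>m\<close> is \<open>1 m (m-1)\<close>.\<close>

lemma m_mem_Z_neg: "of_int m \<in> Z_neg \<beta>"
proof -
  obtain u where u: "\<beta> * u = 1" "\<beta> * u ^ 2 = u" "\<beta> * u ^ 3 = u ^ 2" "\<beta> * u ^ 4 = u ^ 3"
    and m: "of_int m = \<beta> - u" and m_u: "of_int m * u ^ 3 = u ^ 2 - u ^ 4" and u_def: "1 / \<beta> = u"
    and u_bounds: "0 < u" "u < 1 / 2" "0 < u ^ 4" "u ^ 4 \<le> u ^ 3" "u ^ 3 \<le> u ^ 2 / 2" "u ^ 2 \<le> u / 2"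
    by (rule inverse_powers)
  note simps = algebra_simps u m
  \<comment> \<open>The exponent 3 provides for exactly three integer digits.\<close>
  have "of_int m / (- \<beta>) ^ 3 = - (of_int m * (1 / \<beta>) ^ 3)"
    by (simp add: power_divide)
  also have "\<dots> = u ^ 4 - u ^ 2"
    unfolding u_def using m_u by linarith
  finally have w: "of_int m / (- \<beta>) ^ 3 = u ^ 4 - u ^ 2" .
  have J: "of_int m / (- \<beta>) ^ 3 \<in> J_neg \<beta>"
    unfolding w J_neg_frac_iff by (intro conjI; simp add: simps; use u_bounds beta_gt_2 in linarith)
  have "T_neg \<beta> (u ^ 4 - u ^ 2) = u - u ^ 3 - 1"
  proof (rule T_neg_eqI[OF beta_gt_1, of _ 1])
    show "u - u ^ 3 - 1 \<in> I_neg \<beta>"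
      unfolding I_neg_frac_iff by (intro conjI; simp add: simps; use u_bounds beta_gt_2 in linarith)
  qed (simp add: simps)
  moreover have "T_neg \<beta> (u - u ^ 3 - 1) = u ^ 2 + u - 1"
  proof (rule T_neg_eqI[OF beta_gt_1, of _ m])
    show "u ^ 2 + u - 1 \<in> I_neg \<beta>"
      unfolding I_neg_frac_iff by (intro conjI; simp add: simps; use u_bounds beta_gt_2 in linarith)
  qed (simp add: simps)
  moreover have "T_neg \<beta> (u ^ 2 + u - 1) = 0"
  proof (rule T_neg_eqI[OF beta_gt_1, of _ "m - 1"])
    show "0 \<in> I_neg \<beta>" using zero_mem_J_neg[OF beta_gt_1] by simp
  qed (simp add: simps)
  ultimately have "(T_neg \<beta> ^^ 3) (u ^ 4 - u ^ 2) = 0"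
    by (simp add: eval_nat_numeral)
  then show ?thesis using Z_neg_iff[OF beta_gt_1 J] w by simp
qed

text \<open>For \<open>m \<ge> 3\<close> the number 2 is a single digit, as
  \<open>2 / \<beta> < \<beta> / (\<beta> + 1)\<close>. For \<open>m = 2\<close> this inequality
  fails, and the three-digit expansion of \<open>m\<close> takes over.\<close>

lemma two_mem_Z_neg: "2 \<in> Z_neg \<beta>"
proof (cases "m = 2")
  case True
  then show ?thesis using m_mem_Z_neg by simp
next
  case False
  then have "3 \<le> m" using m_ge_2 by simp
  then have "3 < \<beta>" using beta_gt_m by linarith
  moreover from this have "3 * \<beta> < \<beta> * \<beta>" by (intro mult_strict_right_mono) auto
  ultimately have "2 * \<beta> + 2 < \<beta> * \<beta>" by linarith
  then have J: "2 / (- \<beta>) ^ 1 \<in> J_neg \<beta>"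
    unfolding J_neg_frac_iff using beta_gt_1 by (simp add: field_simps)
  have "T_neg \<beta> (2 / (- \<beta>) ^ 1) = 0"
  proof (rule T_neg_eqI[OF beta_gt_1, of _ 2])
    show "0 \<in> I_neg \<beta>" using zero_mem_J_neg[OF beta_gt_1] by simp
  qed (use beta_gt_1 in simp)
  then show ?thesis using Z_neg_iff[OF beta_gt_1 J] by simp
qed

text \<open>Starting from exponent 3, the orbit reaches 0 after four steps with digits 1,
  \<open>m - 1\<close>, \<open>m - 1\<close>, 1; the fourth is the fractional one.\<close>

lemma double_m_mem_Fin_neg: "of_int (2 * m) \<in> Fin_neg \<beta>"
proof -
  obtain u where u: "\<beta> * u = 1" "\<beta> * u ^ 2 = u" "\<beta> * u ^ 3 = u ^ 2" "\<beta> * u ^ 4 = u ^ 3"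
    and m: "of_int m = \<beta> - u" and m_u: "of_int m * u ^ 3 = u ^ 2 - u ^ 4" and u_def: "1 / \<beta> = u"
    and u_bounds: "0 < u" "u < 1 / 2" "0 < u ^ 4" "u ^ 4 \<le> u ^ 3" "u ^ 3 \<le> u ^ 2 / 2" "u ^ 2 \<le> u / 2"
    by (rule inverse_powers)
  have u2: "\<beta> * (u * 2) = 2" "\<beta> * (2 * u ^ 2) = 2 * u" "\<beta> * (2 * u ^ 3) = 2 * u ^ 2"
      "\<beta> * (2 * u ^ 4) = 2 * u ^ 3"
    using u by simp_all
  note simps = algebra_simps u u2 m
  have "of_int (2 * m) / (- \<beta>) ^ 3 = - (2 * of_int m * (1 / \<beta>) ^ 3)"
    by (simp add: power_divide)
  also have "\<dots> = 2 * u ^ 4 - 2 * u ^ 2"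
    unfolding u_def using m_u by linarith
  finally have w: "of_int (2 * m) / (- \<beta>) ^ 3 = 2 * u ^ 4 - 2 * u ^ 2" .
  have J: "of_int (2 * m) / (- \<beta>) ^ 3 \<in> J_neg \<beta>"
    unfolding w J_neg_frac_iff by (intro conjI; simp add: simps; use u_bounds beta_gt_2 in linarith)
  have "T_neg \<beta> (2 * u ^ 4 - 2 * u ^ 2) = 2 * u - 2 * u ^ 3 - 1"
  proof (rule T_neg_eqI[OF beta_gt_1, of _ 1])
    show "2 * u - 2 * u ^ 3 - 1 \<in> I_neg \<beta>"
      unfolding I_neg_frac_iff by (intro conjI; simp add: simps; use u_bounds beta_gt_2 in linarith)
  qed (simp add: simps)
  moreover have "T_neg \<beta> (2 * u - 2 * u ^ 3 - 1) = 2 * u ^ 2 + u - 1"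
  proof (rule T_neg_eqI[OF beta_gt_1, of _ "m - 1"])
    show "2 * u ^ 2 + u - 1 \<in> I_neg \<beta>"
      unfolding I_neg_frac_iff by (intro conjI; simp add: simps; use u_bounds beta_gt_2 in linarith)
  qed (simp add: simps)
  moreover have "T_neg \<beta> (2 * u ^ 2 + u - 1) = - u"
  proof (rule T_neg_eqI[OF beta_gt_1, of _ "m - 1"])
    show "- u \<in> I_neg \<beta>"
      unfolding I_neg_frac_iff by (intro conjI; simp add: simps; use u_bounds beta_gt_2 in linarith)
  qed (simp add: simps)
  moreover have "T_neg \<beta> (- u) = 0"
  proof (rule T_neg_eqI[OF beta_gt_1, of _ 1])
    show "0 \<in> I_neg \<beta>" using zero_mem_J_neg[OF beta_gt_1] by simp
  qed (simp add: simps)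
  ultimately have "(T_neg \<beta> ^^ 4) (2 * u ^ 4 - 2 * u ^ 2) = 0"
    by (simp add: eval_nat_numeral)
  then show ?thesis unfolding Fin_neg_iff[OF beta_gt_1 J] w by blast
qed

lemma double_m_notin_Z_neg: "of_int (2 * m) \<notin> Z_neg \<beta>"
proof
  assume "of_int (2 * m) \<in> Z_neg \<beta>"
  then obtain c where "conj_rel (of_int (2 * m)) c" "c < \<beta>"
    by (rule conj_rel_Z_neg)
  then have "of_int (2 * m) < \<beta>"
    using conj_rel_unique[OF conj_rel_int[of "2 * m"]] by blast
  then show False using beta_less m_ge_2 by simp
qed

end

section \<open>Evaluation of the two minima\<close>

lemma scaled_Z_neg_0: "scaled_Z_neg \<beta> 0 = Z_neg \<beta>"
  by (simp add: scaled_Z_neg_def)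

lemma Inf_enat_eq_1:
  assumes "1 \<in> A" "0 \<notin> A"
  shows "Inf (enat ` A) = 1"
proof (rule antisym)
  show "Inf (enat ` A) \<le> 1"
    using assms(1) by (intro Inf_lower) (simp add: one_enat_def)
  show "1 \<le> Inf (enat ` A)"
    using assms(2) by (intro Inf_greatest) (auto simp: one_enat_def Suc_le_eq intro: gr0I)
qed

theorem theorem14:
  fixes m :: int and \<beta> :: real
  assumes "m \<ge> 2" and "\<beta> > 1" and "\<beta>\<^sup>2 = of_int m * \<beta> + 1"
  shows "L_oplus \<beta> = 1 \<and> L_otimes \<beta> = 1"
proof -
  interpret quadratic_unit m \<beta>
    using assms by unfold_locales
  \<comment> \<open>The one number \<open>2 * m\<close> refutes \<open>l = 0\<close> for both
    operations.\<close>
  have sum: "of_int m + of_int m = (of_int (2 * m) :: real)"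
    and prod: "2 * of_int m = (of_int (2 * m) :: real)"
    by simp_all
  have "L_oplus \<beta> = 1"
    unfolding L_oplus_def
  proof (rule Inf_enat_eq_1)
    show "0 \<notin> {l. \<forall>x\<in>Z_neg \<beta>. \<forall>y\<in>Z_neg \<beta>. x + y \<in> Fin_neg \<beta> \<longrightarrow> x + y \<in> scaled_Z_neg \<beta> l}"
      using m_mem_Z_neg double_m_mem_Fin_neg double_m_notin_Z_neg
      unfolding scaled_Z_neg_0 mem_Collect_eq by (metis sum)
  qed (use Z_neg_add_Fin_neg in blast)
  moreover have "L_otimes \<beta> = 1"
    unfolding L_otimes_def
  proof (rule Inf_enat_eq_1)
    show "0 \<notin> {l. \<forall>x\<in>Z_neg \<beta>. \<forall>y\<in>Z_neg \<beta>. x * y \<in> Fin_neg \<beta> \<longrightarrow> x * y \<in> scaled_Z_neg \<beta> l}"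
      using m_mem_Z_neg two_mem_Z_neg double_m_mem_Fin_neg double_m_notin_Z_neg
      unfolding scaled_Z_neg_0 mem_Collect_eq by (metis prod)
  qed (use Z_neg_mult_Fin_neg in blast)
  ultimately show ?thesis ..
qed

end
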